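(* Let $1<p,q<\infty$. Let $\mu$ be a finite Borel measure on $G$ and let $\omega\in\widehat{G}$. Then a Borel measure $\nu$ on $\widehat{G}$ is a $(p,q)$-frame measure for $\mu$ if and only if $\delta_\omega\ast\nu$ is a $(p,q)$-frame measure for $\mu$, with the same frame bounds.
   Context: $G$ is a locally compact Hausdorff abelian (LCA) group, written additively, which is metrizable and a countable union of compact sets; $\widehat{G}$ is its dual group (continuous characters, written additively), and $\langle x,\gamma\rangle$ denotes the value of $\gamma\in\widehat{G}$ at $x\in G$. Measures are non-negative. $\delta_\omega$ is the Dirac measure at $\omega$, and $(\delta_\omega\ast\nu)(E)=\nu(E-\omega)$ for Borel $E\subset\widehat{G}$. For a finite Borel measure $\mu$ on $G$ and $f\in L^1(\mu)$, $\widehat{fd\mu}(\gamma)=\int_G f(x)\overline{\langle x,\gamma\rangle}\,d\mu(x)$ for $\gamma\in\widehat{G}$. A Borel measure $\nu$ on $\widehat{G}$ is a $(p,q)$-frame measure for $\mu$ with frame bounds $A,B$ if $0<A\le B<\infty$ and $A\|f\|_{L^p(\mu)}^q\le\|\widehat{fd\mu}\|_{L^q(\nu)}^q\le B\|f\|_{L^p(\mu)}^q$ for all $f\in L^p(\mu)$. *)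

theory Defs
  imports "HOL-Analysis.Analysis"
begin

section \<open>The dual group\<close>

typedef (overloaded) 'a dual_group =
  "{\<gamma> :: 'a::topological_ab_group_add \<Rightarrow> complex.
      continuous_on UNIV \<gamma> \<and> (\<forall>x. cmod (\<gamma> x) = 1) \<and> (\<forall>x y. \<gamma> (x + y) = \<gamma> x * \<gamma> y)}"
  morphisms pairing Abs_dual_group
  by (rule exI[of _ "\<lambda>_. 1"]) simp

setup_lifting type_definition_dual_group

lemma continuous_on_pairing: "continuous_on UNIV (pairing \<gamma>)"
  using pairing[of \<gamma>] by simp

lemma norm_pairing [simp]: "cmod (pairing \<gamma> x) = 1"
  using pairing[of \<gamma>] by simp

lemma pairing_add_left: "pairing \<gamma> (x + y) = pairing \<gamma> x * pairing \<gamma> y"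
  using pairing[of \<gamma>] by simp

lemma cnj_pairing_mult [simp]: "cnj (pairing \<gamma> x) * pairing \<gamma> x = 1"
  using complex_norm_square[of "pairing \<gamma> x"] by (metis mult.commute norm_pairing of_real_1 power_one)

instantiation dual_group :: (topological_ab_group_add) ab_group_add
begin

lift_definition zero_dual_group :: "'a dual_group" is "\<lambda>_. 1"
  by simp

lift_definition plus_dual_group :: "'a dual_group \<Rightarrow> 'a dual_group \<Rightarrow> 'a dual_group"
  is "\<lambda>\<gamma> \<delta> x. \<gamma> x * \<delta> x"
  by (simp add: continuous_on_mult norm_mult mult_ac)

lift_definition uminus_dual_group :: "'a dual_group \<Rightarrow> 'a dual_group"
  is "\<lambda>\<gamma> x. cnj (\<gamma> x)"
  by (simp add: continuous_on_cnj)

definition minus_dual_group :: "'a dual_group \<Rightarrow> 'a dual_group \<Rightarrow> 'a dual_group"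
  where "\<gamma> - \<delta> = \<gamma> + - \<delta>" for \<gamma> \<delta> :: "'a dual_group"

instance
proof
  fix a b c :: "'a dual_group"
  show "a + b + c = a + (b + c)" by transfer (simp add: mult.assoc)
  show "a + b = b + a" by transfer (simp add: mult.commute)
  show "0 + a = a" by transfer simp
  show "- a + a = 0"
    by (rule pairing_inject[THEN iffD1], rule ext)
      (simp add: plus_dual_group.rep_eq uminus_dual_group.rep_eq zero_dual_group.rep_eq)
  show "a - b = a + - b" by (rule minus_dual_group_def)
qed

end

text \<open>The topology of uniform convergence on compact sets, that is, the compact-open topology.\<close>

definition dual_group_nhd :: "'a::topological_ab_group_add dual_group \<Rightarrow> 'a set \<Rightarrow> real \<Rightarrow> 'a dual_group set"
  where "dual_group_nhd \<gamma> K e = {\<delta>. \<forall>x\<in>K. dist (pairing \<delta> x) (pairing \<gamma> x) < e}"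

instantiation dual_group :: (topological_ab_group_add) topological_space
begin

definition open_dual_group :: "'a dual_group set \<Rightarrow> bool" where
  "open S \<longleftrightarrow> (\<forall>\<gamma>\<in>S. \<exists>K e. compact K \<and> e > 0 \<and> dual_group_nhd \<gamma> K e \<subseteq> S)"
  for S :: "'a dual_group set"

instance
proof
  show "open (UNIV :: 'a dual_group set)"
    unfolding open_dual_group_def
    by (intro ballI exI[of _ "{}"] exI[of _ "1::real"]) simp
next
  fix S T :: "'a dual_group set"
  assume S: "open S" and T: "open T"
  show "open (S \<inter> T)"
    unfolding open_dual_group_def
  proof
    fix \<gamma> assume \<gamma>: "\<gamma> \<in> S \<inter> T"
    obtain K d where K: "compact K" "d > 0" "dual_group_nhd \<gamma> K d \<subseteq> S"
      using S \<gamma> unfolding open_dual_group_def by blast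
    obtain L e where L: "compact L" "e > 0" "dual_group_nhd \<gamma> L e \<subseteq> T"
      using T \<gamma> unfolding open_dual_group_def by blast
    have "dual_group_nhd \<gamma> (K \<union> L) (min d e) \<subseteq> dual_group_nhd \<gamma> K d \<inter> dual_group_nhd \<gamma> L e"
      by (auto simp: dual_group_nhd_def)
    with K L show "\<exists>K e. compact K \<and> e > 0 \<and> dual_group_nhd \<gamma> K e \<subseteq> S \<inter> T"
      by (intro exI[of _ "K \<union> L"] exI[of _ "min d e"]) (auto simp: compact_Un)
  qed
next
  fix \<S> :: "'a dual_group set set"
  assume \<S>: "\<forall>S\<in>\<S>. open S"
  show "open (\<Union>\<S>)"
    unfolding open_dual_group_def
  proof
    fix \<gamma> assume "\<gamma> \<in> \<Union>\<S>"
    then obtain S where S: "S \<in> \<S>" "\<gamma> \<in> S" by blast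
    with \<S> have "open S" by blast
    with S obtain K e where "compact K" "e > 0" "dual_group_nhd \<gamma> K e \<subseteq> S"
      unfolding open_dual_group_def by blast
    with S show "\<exists>K e. compact K \<and> e > 0 \<and> dual_group_nhd \<gamma> K e \<subseteq> \<Union>\<S>"
      by blast
  qed
qed

end

lemma eventually_nhds_dual_group:
  "eventually P (nhds \<gamma>) \<longleftrightarrow>
    (\<exists>K e. compact K \<and> e > 0 \<and> (\<forall>\<delta>\<in>dual_group_nhd \<gamma> K e. P \<delta>))"
proof
  assume "eventually P (nhds \<gamma>)"
  then obtain S where S: "open S" "\<gamma> \<in> S" "\<forall>\<delta>\<in>S. P \<delta>"
    unfolding eventually_nhds by blast
  then obtain K e where "compact K" "e > 0" "dual_group_nhd \<gamma> K e \<subseteq> S"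
    unfolding open_dual_group_def by blast
  with S(3) show "\<exists>K e. compact K \<and> e > 0 \<and> (\<forall>\<delta>\<in>dual_group_nhd \<gamma> K e. P \<delta>)"
    by blast
next
  assume "\<exists>K e. compact K \<and> e > 0 \<and> (\<forall>\<delta>\<in>dual_group_nhd \<gamma> K e. P \<delta>)"
  then obtain K e where K: "compact K" "e > 0" "\<forall>\<delta>\<in>dual_group_nhd \<gamma> K e. P \<delta>"
    by blast
  define S where "S = {\<delta>. \<exists>d<e. \<forall>x\<in>K. dist (pairing \<delta> x) (pairing \<gamma> x) \<le> d}"
  have "open S"
    unfolding open_dual_group_def
  proof
    fix \<delta> assume "\<delta> \<in> S"
    then obtain d where d: "d < e" "\<forall>x\<in>K. dist (pairing \<delta> x) (pairing \<gamma> x) \<le> d"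
      unfolding S_def by blast
    have "dual_group_nhd \<delta> K ((e - d) / 2) \<subseteq> S"
    proof
      fix \<delta>' assume \<delta>': "\<delta>' \<in> dual_group_nhd \<delta> K ((e - d) / 2)"
      have "dist (pairing \<delta>' x) (pairing \<gamma> x) \<le> (e + d) / 2" if "x \<in> K" for x
      proof -
        have "dist (pairing \<delta>' x) (pairing \<gamma> x)
            \<le> dist (pairing \<delta>' x) (pairing \<delta> x) + dist (pairing \<delta> x) (pairing \<gamma> x)"
          by (rule dist_triangle)
        moreover have "dist (pairing \<delta>' x) (pairing \<delta> x) < (e - d) / 2"
          using \<delta>' that unfolding dual_group_nhd_def by blast
        moreover have "dist (pairing \<delta> x) (pairing \<gamma> x) \<le> d"
          using d(2) that by blast
        ultimately show ?thesis by argo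
      qed
      moreover have "(e + d) / 2 < e" using d(1) by simp
      ultimately show "\<delta>' \<in> S" unfolding S_def by blast
    qed
    moreover have "(e - d) / 2 > 0" using d(1) by simp
    ultimately show "\<exists>K e. compact K \<and> e > 0 \<and> dual_group_nhd \<delta> K e \<subseteq> S"
      using K(1) by blast
  qed
  moreover have "\<gamma> \<in> S"
    unfolding S_def using K(2) by (intro CollectI exI[of _ 0]) simp
  moreover have "S \<subseteq> dual_group_nhd \<gamma> K e"
    unfolding S_def dual_group_nhd_def by (auto intro: le_less_trans)
  ultimately show "eventually P (nhds \<gamma>)"
    unfolding eventually_nhds using K(3) by blast
qed

instance dual_group :: (topological_ab_group_add) t2_space
proof
  fix \<gamma> \<delta> :: "'a dual_group"
  assume "\<gamma> \<noteq> \<delta>"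
  then obtain x where x: "pairing \<gamma> x \<noteq> pairing \<delta> x"
    by (metis pairing_inject ext)
  define e where "e = dist (pairing \<gamma> x) (pairing \<delta> x) / 2"
  have e: "e > 0" using x by (simp add: e_def)
  have "eventually (\<lambda>\<eta>. dist (pairing \<eta> x) (pairing \<alpha> x) < e) (nhds \<alpha>)" for \<alpha>
    unfolding eventually_nhds_dual_group using e
    by (intro exI[of _ "{x}"] exI[of _ e]) (simp add: dual_group_nhd_def)
  note ev = this[unfolded eventually_nhds]
  obtain U where U: "open U" "\<gamma> \<in> U" "\<forall>\<eta>\<in>U. dist (pairing \<eta> x) (pairing \<gamma> x) < e"
    using ev[of \<gamma>] by blast
  obtain V where V: "open V" "\<delta> \<in> V" "\<forall>\<eta>\<in>V. dist (pairing \<eta> x) (pairing \<delta> x) < e"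
    using ev[of \<delta>] by blast
  have "False" if "\<eta> \<in> U" "\<eta> \<in> V" for \<eta>
    using U(3)[THEN bspec, OF that(1)] V(3)[THEN bspec, OF that(2)] dist_triangle3[of "pairing \<gamma> x" "pairing \<delta> x" "pairing \<eta> x"]
    by (simp add: e_def)
  then show "\<exists>U V. open U \<and> open V \<and> \<gamma> \<in> U \<and> \<delta> \<in> V \<and> U \<inter> V = {}"
    using U V by blast
qed

instance dual_group :: (topological_ab_group_add) topological_ab_group_add
proof
  fix a b :: "'a dual_group"
  show "LIM x (nhds a \<times>\<^sub>F nhds b). fst x + snd x :> nhds (a + b)"
    unfolding filterlim_iff
  proof (intro allI impI)
    fix P :: "'a dual_group \<Rightarrow> bool"
    assume "eventually P (nhds (a + b))"
    then obtain K e where K: "compact K" "e > 0"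
        "\<forall>\<delta>\<in>dual_group_nhd (a + b) K e. P \<delta>"
      unfolding eventually_nhds_dual_group by blast
    have nhd: "eventually (\<lambda>\<delta>. \<delta> \<in> dual_group_nhd c K (e / 2)) (nhds c)" for c
      unfolding eventually_nhds_dual_group
      using K(1,2) by (intro exI[of _ K] exI[of _ "e / 2"]) simp
    have "P (\<delta> + \<delta>')"
      if "\<delta> \<in> dual_group_nhd a K (e / 2)" "\<delta>' \<in> dual_group_nhd b K (e / 2)" for \<delta> \<delta>'
    proof (rule K(3)[THEN bspec], unfold dual_group_nhd_def, intro CollectI ballI)
      fix x assume "x \<in> K"
      have "dist (pairing (\<delta> + \<delta>') x) (pairing (a + b) x)
          = cmod ((pairing \<delta> x - pairing a x) * pairing \<delta>' x
                   + pairing a x * (pairing \<delta>' x - pairing b x))"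
        by (simp add: dist_norm plus_dual_group.rep_eq algebra_simps)
      also have "\<dots> \<le> dist (pairing \<delta> x) (pairing a x) + dist (pairing \<delta>' x) (pairing b x)"
        by (rule order_trans[OF norm_triangle_ineq]) (simp add: norm_mult dist_norm)
      also have "\<dots> < e / 2 + e / 2"
        using that \<open>x \<in> K\<close> unfolding dual_group_nhd_def by (intro add_strict_mono) auto
      finally show "dist (pairing (\<delta> + \<delta>') x) (pairing (a + b) x) < e" by simp
    qed
    then show "eventually (\<lambda>x. P (fst x + snd x)) (nhds a \<times>\<^sub>F nhds b)"
      unfolding eventually_prod_filter using nhd[of a] nhd[of b] by force
  qed
next
  fix a :: "'a dual_group"
  have dist_uminus: "dist (pairing (- \<delta>) x) (pairing (- \<gamma>) x) = dist (pairing \<delta> x) (pairing \<gamma> x)"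
    for \<delta> \<gamma> :: "'a dual_group" and x
    unfolding dist_norm uminus_dual_group.rep_eq by (metis complex_cnj_diff complex_mod_cnj)
  show "(uminus \<longlongrightarrow> - a) (nhds a)"
    unfolding filterlim_iff
  proof (intro allI impI)
    fix P :: "'a dual_group \<Rightarrow> bool"
    assume "eventually P (nhds (- a))"
    then obtain K e where K: "compact K" "e > 0"
        "\<forall>\<delta>\<in>dual_group_nhd (- a) K e. P \<delta>"
      unfolding eventually_nhds_dual_group by blast
    have "P (- \<delta>)" if "\<delta> \<in> dual_group_nhd a K e" for \<delta>
      using that by (intro K(3)[THEN bspec]) (simp add: dual_group_nhd_def dist_uminus)
    then show "eventually (\<lambda>x. P (- x)) (nhds a)"
      unfolding eventually_nhds_dual_group using K(1,2) by blast
  qed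
qed

section \<open>Translates of measures on the dual group\<close>

definition dirac_convolution ::
    "'a::topological_ab_group_add dual_group \<Rightarrow> 'a dual_group measure \<Rightarrow> 'a dual_group measure"
  where "dirac_convolution \<omega> \<nu> =
    measure_of UNIV (sets borel) (\<lambda>E. emeasure \<nu> ((\<lambda>\<gamma>. \<gamma> - \<omega>) ` E))"

text \<open>Since \<^const>\<open>measure_of\<close> is the zero measure when its argument is not countably additive,
  we check that the value is the intended one.\<close>

lemma image_minus_dual_group:
  "(\<lambda>\<gamma>. \<gamma> - \<omega>) ` E = (\<lambda>\<gamma>. \<gamma> + \<omega>) -` E" for E :: "'a::topological_ab_group_add dual_group set"
proof (intro equalityI subsetI)
  fix \<gamma> assume "\<gamma> \<in> (\<lambda>\<gamma>. \<gamma> + \<omega>) -` E"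
  then show "\<gamma> \<in> (\<lambda>\<gamma>. \<gamma> - \<omega>) ` E"
    by (intro image_eqI[of _ _ "\<gamma> + \<omega>"]) simp_all
qed auto

lemma dirac_convolution_eq_distr:
  fixes \<nu> :: "'a::topological_ab_group_add dual_group measure"
  assumes "sets \<nu> = sets borel"
  shows "dirac_convolution \<omega> \<nu> = distr \<nu> borel (\<lambda>\<gamma>. \<gamma> + \<omega>)"
proof -
  have "space \<nu> = UNIV" using sets_eq_imp_space_eq[OF assms] by simp
  moreover have "(\<lambda>\<gamma>. \<gamma> - \<omega>) ` E = (\<lambda>\<gamma>. \<gamma> + \<omega>) -` E" for E :: "'a dual_group set"
    by (rule image_minus_dual_group)
  ultimately show ?thesis
    unfolding dirac_convolution_def distr_def by simp
qed

lemma
  fixes \<nu> :: "'a::topological_ab_group_add dual_group measure"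
  assumes "sets \<nu> = sets borel"
  shows sets_dirac_convolution: "sets (dirac_convolution \<omega> \<nu>) = sets borel"
    and emeasure_dirac_convolution: "E \<in> sets borel \<Longrightarrow>
      emeasure (dirac_convolution \<omega> \<nu>) E = emeasure \<nu> ((\<lambda>\<gamma>. \<gamma> - \<omega>) ` E)"
proof -
  show "sets (dirac_convolution \<omega> \<nu>) = sets borel"
    unfolding dirac_convolution_eq_distr[OF assms] by simp
next
  assume E: "E \<in> sets borel"
  have sp: "space \<nu> = UNIV" using sets_eq_imp_space_eq[OF assms] by simp
  have "(\<lambda>\<gamma>. \<gamma> + \<omega>) \<in> borel_measurable borel"
    by (intro borel_measurable_continuous_onI continuous_intros)
  then have "(\<lambda>\<gamma>. \<gamma> + \<omega>) \<in> borel_measurable \<nu>"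
    by (simp only: measurable_cong_sets[OF assms refl])
  moreover have "(\<lambda>\<gamma>. \<gamma> - \<omega>) ` E = (\<lambda>\<gamma>. \<gamma> + \<omega>) -` E"
    by (rule image_minus_dual_group)
  ultimately show "emeasure (dirac_convolution \<omega> \<nu>) E = emeasure \<nu> ((\<lambda>\<gamma>. \<gamma> - \<omega>) ` E)"
    using emeasure_distr[OF _ E, of "\<lambda>\<gamma>. \<gamma> + \<omega>" \<nu>]
    by (simp only: dirac_convolution_eq_distr[OF assms] sp Int_UNIV_right)
qed

section \<open>Frame measures\<close>

text \<open>Powers with positive real exponent on the extended half-line.\<close>

definition ennreal_powr :: "ennreal \<Rightarrow> real \<Rightarrow> ennreal" where
  "ennreal_powr x r = (if x = top then top else ennreal (enn2real x powr r))"

definition Lp_norm :: "real \<Rightarrow> 'b measure \<Rightarrow> ('b \<Rightarrow> complex) \<Rightarrow> ennreal" where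
  "Lp_norm p M f = ennreal_powr (\<integral>\<^sup>+x. ennreal (cmod (f x) powr p) \<partial>M) (1 / p)"

definition Lp_space :: "real \<Rightarrow> 'b measure \<Rightarrow> ('b \<Rightarrow> complex) set" where
  "Lp_space p M = {f \<in> borel_measurable M. Lp_norm p M f < top}"

definition fourier ::
    "'a::topological_ab_group_add measure \<Rightarrow> ('a \<Rightarrow> complex) \<Rightarrow> 'a dual_group \<Rightarrow> complex"
  where "fourier \<mu> f \<gamma> = (LINT x|\<mu>. f x * cnj (pairing \<gamma> x))"

definition frame_measure ::
    "real \<Rightarrow> real \<Rightarrow> 'a::topological_ab_group_add measure \<Rightarrow> real \<Rightarrow> real \<Rightarrow> 'a dual_group measure \<Rightarrow> bool"
  where "frame_measure p q \<mu> A B \<nu> \<longleftrightarrow>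
    sets \<nu> = sets borel \<and> 0 < A \<and> A \<le> B \<and>
    (\<forall>f\<in>Lp_space p \<mu>.
      ennreal A * ennreal_powr (Lp_norm p \<mu> f) q \<le> ennreal_powr (Lp_norm q \<nu> (fourier \<mu> f)) q \<and>
      ennreal_powr (Lp_norm q \<nu> (fourier \<mu> f)) q \<le> ennreal B * ennreal_powr (Lp_norm p \<mu> f) q)"

end

(* Translating by \<omega> turns the transform of f into the transform of the modulation f \<langle>\<cdot>, -\<omega>\<rangle>,
   and modulation by a character maps L^p isometrically into itself; the inverse translation gives the
   converse.  Since a translation is invertible, change of variables for the lower integral holds
   without measurability of the integrand, so continuity of the transform plays no role. *)
theory Submission
  imports Defs
begin

text \<open>The integral of \<open>g\<close> is a supremum over simple \<open>s\<close> below
  \<open>g\<close>. Each such \<open>s\<close> is measurable, so the usual change of variables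
  applies to it, and \<open>s\<close> composed with \<open>T\<close> stays below \<open>g\<close>
  composed with \<open>T\<close>.\<close>

lemma nn_integral_distr_le:
  assumes T: "T \<in> measurable M N"
  shows "(\<integral>\<^sup>+y. g y \<partial>distr M N T) \<le> (\<integral>\<^sup>+x. g (T x) \<partial>M)"
  unfolding nn_integral_def[of "distr M N T"]
proof (rule SUP_least, clarify)
  fix s assume s: "simple_function (distr M N T) s" and le: "s \<le> g"
  have "integral\<^sup>S (distr M N T) s = (\<integral>\<^sup>+y. s y \<partial>distr M N T)"
    using s by (simp add: nn_integral_eq_simple_integral)
  also have "\<dots> = (\<integral>\<^sup>+x. s (T x) \<partial>M)"
    using borel_measurable_simple_function[OF s] by (intro nn_integral_distr[OF T]) simp
  also have "\<dots> \<le> (\<integral>\<^sup>+x. g (T x) \<partial>M)"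
    using le by (intro nn_integral_mono) (simp add: le_fun_def)
  finally show "integral\<^sup>S (distr M N T) s \<le> (\<integral>\<^sup>+x. g (T x) \<partial>M)" .
qed

text \<open>The missing inequality is the previous lemma for \<open>S\<close>, which pushes
  \<open>distr M N T\<close> back to \<open>M\<close>.\<close>

lemma nn_integral_distr_inverse:
  assumes T: "T \<in> measurable M N" and S: "S \<in> measurable N M"
    and ST: "\<And>x. x \<in> space M \<Longrightarrow> S (T x) = x" and TS: "\<And>y. T (S y) = y"
  shows "(\<integral>\<^sup>+y. g y \<partial>distr M N T) = (\<integral>\<^sup>+x. g (T x) \<partial>M)"
proof (rule antisym[OF nn_integral_distr_le[OF T]])
  have S': "S \<in> measurable (distr M N T) M" using S by simp
  have "distr (distr M N T) M S = distr M M (S \<circ> T)"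
    by (rule distr_distr[OF S T])
  also have "\<dots> = M"
    \<comment> \<open>\<open>S \<circ> T\<close> is known to be the identity on
      \<open>space M\<close> only, hence the congruence step before \<open>distr_id\<close>.\<close>
    using ST by (intro distr_cong[of M M M M "S \<circ> T" "\<lambda>x. x", THEN trans] distr_id) auto
  finally have "(\<integral>\<^sup>+x. g (T x) \<partial>M) = (\<integral>\<^sup>+x. g (T x) \<partial>distr (distr M N T) M S)"
    by simp
  also have "\<dots> \<le> (\<integral>\<^sup>+y. g y \<partial>distr M N T)"
    using nn_integral_distr_le[OF S', of "\<lambda>x. g (T x)"] by (simp add: TS)
  finally show "(\<integral>\<^sup>+x. g (T x) \<partial>M) \<le> (\<integral>\<^sup>+y. g y \<partial>distr M N T)" .
qed

lemma measurable_dual_group_translation: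
  fixes \<omega> :: "'a::topological_ab_group_add dual_group"
  shows "(\<lambda>\<gamma>. \<gamma> + \<omega>) \<in> borel_measurable borel"
  by (intro borel_measurable_continuous_onI continuous_intros)

lemma Lp_norm_dirac_convolution:
  fixes \<nu> :: "'a::topological_ab_group_add dual_group measure"
  assumes sets: "sets \<nu> = sets borel"
  shows "Lp_norm q (dirac_convolution \<omega> \<nu>) g = Lp_norm q \<nu> (\<lambda>\<gamma>. g (\<gamma> + \<omega>))"
proof -
  have "(\<lambda>\<gamma>. \<gamma> + \<omega>) \<in> measurable \<nu> borel"
    using measurable_dual_group_translation
    by (simp only: measurable_cong_sets[OF sets refl])
  \<comment> \<open>Written with \<open>+ - \<omega>\<close>, the inverse map is itself an instance
    of the translation lemma.\<close>
  moreover have "(\<lambda>\<gamma>. \<gamma> + - \<omega>) \<in> measurable borel \<nu>"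
    using measurable_dual_group_translation
    by (simp only: measurable_cong_sets[OF refl sets])
  ultimately show ?thesis
    unfolding Lp_norm_def dirac_convolution_eq_distr[OF sets]
    by (subst nn_integral_distr_inverse[where S = "\<lambda>\<gamma>. \<gamma> + - \<omega>"]) (simp_all add: add.assoc)
qed

text \<open>The value of a sum of characters is a product, so the conjugated factor of \<omega> can
  be absorbed into \<open>f\<close>.\<close>

lemma fourier_add:
  "fourier \<mu> f (\<gamma> + \<omega>) = fourier \<mu> (\<lambda>x. f x * cnj (pairing \<omega> x)) \<gamma>"
  unfolding fourier_def by (simp add: plus_dual_group.rep_eq mult_ac)

text \<open>Characters have modulus one, so the integrands agree pointwise.\<close>

lemma Lp_norm_modulation:
  "Lp_norm p \<mu> (\<lambda>x. f x * cnj (pairing \<omega> x)) = Lp_norm p \<mu> f"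
  unfolding Lp_norm_def by (simp add: norm_mult)

lemma modulation_in_Lp_space:
  fixes \<mu> :: "'a::topological_ab_group_add measure"
  assumes sets: "sets \<mu> = sets borel" and f: "f \<in> Lp_space p \<mu>"
  shows "(\<lambda>x. f x * cnj (pairing \<omega> x)) \<in> Lp_space p \<mu>"
proof -
  have "(\<lambda>x. cnj (pairing \<omega> x)) \<in> borel_measurable borel"
    by (intro borel_measurable_continuous_onI continuous_on_cnj continuous_on_pairing)
  then have "(\<lambda>x. cnj (pairing \<omega> x)) \<in> borel_measurable \<mu>"
    by (simp only: measurable_cong_sets[OF sets refl])
  then show ?thesis
    using f by (simp add: Lp_space_def Lp_norm_modulation borel_measurable_times)
qed

text \<open>The inequalities for the translate at \<open>f\<close> are those for \<nu> at the
  modulated function, which explains why \<open>A\<close> and \<open>B\<close> survive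
  unchanged.\<close>

lemma frame_measure_dirac_convolution:
  fixes \<mu> :: "'a::topological_ab_group_add measure"
  assumes sets: "sets \<mu> = sets borel" and frame: "frame_measure p q \<mu> A B \<nu>"
  shows "frame_measure p q \<mu> A B (dirac_convolution \<omega> \<nu>)"
proof -
  have \<nu>: "sets \<nu> = sets borel" using frame by (simp add: frame_measure_def)
  have norm: "Lp_norm q (dirac_convolution \<omega> \<nu>) (fourier \<mu> f)
      = Lp_norm q \<nu> (fourier \<mu> (\<lambda>x. f x * cnj (pairing \<omega> x)))" for f
    by (simp add: Lp_norm_dirac_convolution[OF \<nu>] fourier_add)
  show ?thesis
    unfolding frame_measure_def norm
  proof (intro conjI ballI)
    fix f assume "f \<in> Lp_space p \<mu>"
    note f = modulation_in_Lp_space[OF sets this, of \<omega>]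
    let ?g = "\<lambda>x. f x * cnj (pairing \<omega> x)"
    show "ennreal A * ennreal_powr (Lp_norm p \<mu> f) q \<le> ennreal_powr (Lp_norm q \<nu> (fourier \<mu> ?g)) q"
      and "ennreal_powr (Lp_norm q \<nu> (fourier \<mu> ?g)) q \<le> ennreal B * ennreal_powr (Lp_norm p \<mu> f) q"
      \<comment> \<open>Read from right to left, the isometry turns the norm of \<open>f\<close>
        into that of \<open>?g\<close>, so the goals become the frame inequalities at
        \<open>?g\<close>.\<close>
      using frame f unfolding frame_measure_def Lp_norm_modulation[of p \<mu> f \<omega>, symmetric] by blast+
  qed (use frame in \<open>auto simp: frame_measure_def sets_dirac_convolution[OF \<nu>]\<close>)
qed

text \<open>This reduces the converse implication to the direct one.\<close>

lemma dirac_convolution_uminus_cancel: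
  fixes \<nu> :: "'a::topological_ab_group_add dual_group measure"
  assumes sets: "sets \<nu> = sets borel"
  shows "dirac_convolution (- \<omega>) (dirac_convolution \<omega> \<nu>) = \<nu>"
proof (rule measure_eqI)
  note sets' = sets_dirac_convolution[OF sets, of \<omega>]
  show "sets (dirac_convolution (- \<omega>) (dirac_convolution \<omega> \<nu>)) = sets \<nu>"
    by (simp add: sets_dirac_convolution[OF sets'] sets)
  fix E assume "E \<in> sets (dirac_convolution (- \<omega>) (dirac_convolution \<omega> \<nu>))"
  then have E: "E \<in> sets borel" by (simp add: sets_dirac_convolution[OF sets'])
  \<comment> \<open>The formula for the inner translate is evaluated at this set, so it has to be
    Borel.\<close>
  have "(\<lambda>\<gamma>. \<gamma> - - \<omega>) ` E \<in> sets borel"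
    using measurable_sets[OF measurable_dual_group_translation E, of "- \<omega>"]
    by (simp only: image_minus_dual_group space_borel Int_UNIV_right)
  then show "emeasure (dirac_convolution (- \<omega>) (dirac_convolution \<omega> \<nu>)) E = emeasure \<nu> E"
    by (simp add: emeasure_dirac_convolution[OF sets'] emeasure_dirac_convolution[OF sets] E image_image)
qed

theorem theorem2p4:
  fixes \<mu> :: "'a::{topological_ab_group_add, t2_space} measure"
    and \<nu> :: "'a dual_group measure"
    and \<omega> :: "'a dual_group"
    and p q :: real
  assumes "locally_compact_space (euclidean :: 'a topology)"
    and "metrizable_space (euclidean :: 'a topology)"
    and "\<exists>K :: nat \<Rightarrow> 'a set. (\<forall>n. compact (K n)) \<and> (\<Union>n. K n) = UNIV"
    and "1 < p" and "1 < q"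
    and "finite_measure \<mu>" and "sets \<mu> = sets borel"
    and "sets \<nu> = sets borel"
  shows "\<forall>A B. frame_measure p q \<mu> A B \<nu> \<longleftrightarrow> frame_measure p q \<mu> A B (dirac_convolution \<omega> \<nu>)"
  \<comment> \<open>For the converse, the first fact is applied to
    \<open>dirac_convolution \<omega> \<nu>\<close> and \<open>- \<omega>\<close>, and the second
    identifies the result with \<nu>.\<close>
  using frame_measure_dirac_convolution[OF assms(7)]
    dirac_convolution_uminus_cancel[OF assms(8)] by metis

end
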